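(* Let $\Omega\subset\mathbb{R}^n$ be open, let $f\in C([0,\infty))$, and let $M>0$ and $\gamma\in[0,3)$ be such that $$0\le f(\delta t)\le M\delta^\gamma f(t)\qquad\text{for bounded } t>0 \text{ and all sufficiently small } \delta>0 .$$ Let $u$ be a bounded non-negative viscosity solution of $\Delta_\infty u=f(u)$ in $\Omega$, and let $x_0\in\partial\{u>0\}\cap\Omega$. Then there exists a constant $C>0$, depending only on $\gamma$, $\|u\|_\infty$ and $\operatorname{dist}(x_0,\partial\Omega)$, such that $$u(x)\le C|x-x_0|^{\frac{4}{3-\gamma}}$$ for all $x\in\{u>0\}$ near $x_0$ (that is, for all $x\in\{u>0\}$ in some neighbourhood of $x_0$).
   Context: The infinity Laplacian is $\Delta_\infty u:=\sum_{i,j=1}^n u_{x_i}u_{x_j}u_{x_ix_j}$. Viscosity solutions: a function $u\in C(\Omega)$ (with values in $[0,\infty)$, where $f$ is defined) is a viscosity super-solution of $\Delta_\infty u=f(u)$ in $\Omega$ if for every $\phi\in C^2(\Omega)$ such that $u-\phi$ has a local minimum at $x_0\in\Omega$ with $\phi(x_0)=u(x_0)$, one has $\Delta_\infty\phi(x_0)\le f(\phi(x_0))$. It is a viscosity sub-solution if for every $\phi\in C^2(\Omega)$ such that $u-\phi$ has a local maximum at $x_0\in\Omega$ with $\phi(x_0)=u(x_0)$, one has $\Delta_\infty\phi(x_0)\ge f(\phi(x_0))$. It is a viscosity solution if it is both. The growth condition "for bounded $t>0$ and all sufficiently small $\delta>0$" means: for every $T>0$ there is $\delta_0>0$ such that the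 inequality holds for all $0<t\le T$ and $0<\delta<\delta_0$. The data $n$, $f$, $M$ of the problem are regarded as fixed when the dependence of $C$ is described. $\|u\|_\infty$ is the supremum norm of $u$ in $\Omega$, and $\{u>0\}=\{x\in\Omega:u(x)>0\}$. *)

theory Defs
  imports "HOL-Analysis.Analysis"
begin

definition partial_deriv :: "'n::finite \<Rightarrow> (real ^ 'n \<Rightarrow> real) \<Rightarrow> real ^ 'n \<Rightarrow> real" where
  "partial_deriv i g x = frechet_derivative g (at x) (axis i 1)"

text \<open>The next two definitions are meant for open \<open>S\<close>, where they describe the usual classes
  \<open>C\<^sup>1(S)\<close> and \<open>C\<^sup>2(S)\<close>.\<close>

definition C1_on :: "(real ^ 'n) set \<Rightarrow> (real ^ 'n::finite \<Rightarrow> real) \<Rightarrow> bool" where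
  "C1_on S g \<longleftrightarrow> (\<forall>x\<in>S. g differentiable (at x)) \<and> (\<forall>i. continuous_on S (partial_deriv i g))"

definition C2_on :: "(real ^ 'n) set \<Rightarrow> (real ^ 'n::finite \<Rightarrow> real) \<Rightarrow> bool" where
  "C2_on S g \<longleftrightarrow> C1_on S g \<and> (\<forall>i. C1_on S (partial_deriv i g))"

definition infinity_Laplacian :: "(real ^ 'n::finite \<Rightarrow> real) \<Rightarrow> real ^ 'n \<Rightarrow> real" where
  "infinity_Laplacian g x =
     (\<Sum>i\<in>UNIV. \<Sum>j\<in>UNIV.
        partial_deriv i g x * partial_deriv j g x * partial_deriv j (partial_deriv i g) x)"

text \<open>The nonlinearity \<open>f\<close> is only meaningful on \<open>[0,\<infinity>)\<close>, so non-negativity of \<open>u\<close> on \<open>\<Omega>\<close> is part of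
  the notion of super- and sub-solution. Values of \<open>u\<close> outside \<open>\<Omega>\<close> are irrelevant.\<close>

definition viscosity_supersolution ::
  "(real \<Rightarrow> real) \<Rightarrow> (real ^ 'n) set \<Rightarrow> (real ^ 'n::finite \<Rightarrow> real) \<Rightarrow> bool" where
  "viscosity_supersolution f \<Omega> u \<longleftrightarrow>
     continuous_on \<Omega> u \<and> (\<forall>x\<in>\<Omega>. 0 \<le> u x) \<and>
     (\<forall>\<phi> x0. C2_on \<Omega> \<phi> \<and> x0 \<in> \<Omega> \<and>
        (\<forall>\<^sub>F x in at x0 within \<Omega>. u x0 - \<phi> x0 \<le> u x - \<phi> x) \<and> \<phi> x0 = u x0 \<longrightarrow>
        infinity_Laplacian \<phi> x0 \<le> f (\<phi> x0))"

definition viscosity_subsolution ::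
  "(real \<Rightarrow> real) \<Rightarrow> (real ^ 'n) set \<Rightarrow> (real ^ 'n::finite \<Rightarrow> real) \<Rightarrow> bool" where
  "viscosity_subsolution f \<Omega> u \<longleftrightarrow>
     continuous_on \<Omega> u \<and> (\<forall>x\<in>\<Omega>. 0 \<le> u x) \<and>
     (\<forall>\<phi> x0. C2_on \<Omega> \<phi> \<and> x0 \<in> \<Omega> \<and>
        (\<forall>\<^sub>F x in at x0 within \<Omega>. u x - \<phi> x \<le> u x0 - \<phi> x0) \<and> \<phi> x0 = u x0 \<longrightarrow>
        infinity_Laplacian \<phi> x0 \<ge> f (\<phi> x0))"

definition viscosity_solution ::
  "(real \<Rightarrow> real) \<Rightarrow> (real ^ 'n) set \<Rightarrow> (real ^ 'n::finite \<Rightarrow> real) \<Rightarrow> bool" where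
  "viscosity_solution f \<Omega> u \<longleftrightarrow> viscosity_supersolution f \<Omega> u \<and> viscosity_subsolution f \<Omega> u"

definition growth_condition :: "(real \<Rightarrow> real) \<Rightarrow> real \<Rightarrow> real \<Rightarrow> bool" where
  "growth_condition f M \<gamma> \<longleftrightarrow>
     (\<forall>T>0. \<exists>\<delta>0>0. \<forall>t \<delta>. 0 < t \<and> t \<le> T \<and> 0 < \<delta> \<and> \<delta> < \<delta>0 \<longrightarrow>
        0 \<le> f (\<delta> * t) \<and> f (\<delta> * t) \<le> M * \<delta> powr \<gamma> * f t)"

definition positivity_set :: "(real ^ 'n) set \<Rightarrow> (real ^ 'n::finite \<Rightarrow> real) \<Rightarrow> (real ^ 'n) set" where
  "positivity_set \<Omega> u = {x \<in> \<Omega>. u x > 0}"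

definition sup_norm_on :: "(real ^ 'n) set \<Rightarrow> (real ^ 'n::finite \<Rightarrow> real) \<Rightarrow> real" where
  "sup_norm_on \<Omega> u = (SUP x\<in>\<Omega>. \<bar>u x\<bar>)"

text \<open>Extended-real valued, so that the distance is \<open>\<infinity>\<close> for \<open>\<Omega> = UNIV\<close>, whose boundary is empty
  (\<open>infdist\<close> would give \<open>0\<close> there).\<close>

definition boundary_dist :: "(real ^ 'n) set \<Rightarrow> real ^ 'n::finite \<Rightarrow> ereal" where
  "boundary_dist \<Omega> x = (INF y\<in>frontier \<Omega>. ereal (dist x y))"

end

theory Submission
  imports Defs
begin

text \<open>The bound comes from an explicit barrier. Put \<open>\<alpha> = 4 / (3 - \<gamma>)\<close>. The profile
  \<open>h(\<rho>) = c (R - \<rho>)\<^sup>\<alpha>\<close> satisfies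
  \<open>h'\<^sup>2 h'' = c\<^bsup>3-\<gamma>\<^esup> \<alpha>\<^sup>3 (\<alpha> - 1) h\<^sup>\<gamma>\<close>, while the growth condition at \<open>t = 1\<close> gives
  \<open>f(s) \<le> M f(1) s\<^sup>\<gamma>\<close> for small \<open>s\<close>. For large \<open>c\<close> the function \<open>h(|x - z|)\<close> is thus a
  strict subsolution away from its centre \<open>z\<close>. If \<open>u(z) > c |z - x\<^sub>0|\<^sup>\<alpha>\<close>, take \<open>R\<close> slightly
  larger than \<open>|z - x\<^sub>0|\<close>: the barrier lies below \<open>u\<close> at \<open>z\<close> and on the sphere of radius \<open>R\<close>,
  hence on the whole ball, contradicting \<open>u(x\<^sub>0) = 0\<close>.\<close>

section \<open>Radial test functions for viscosity supersolutions\<close>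

text \<open>As \<open>D > 0\<close>, \<open>d'\<close> changes sign from negative to positive at
  \<open>x0\<close>, and the mean value theorem on each side turns this into a minimum.
  Differentiability of \<open>d'\<close> at the single point \<open>x0\<close> is enough.\<close>

lemma second_derivative_local_min:
  fixes d d' :: "real \<Rightarrow> real"
  assumes d: "\<forall>\<^sub>F x in nhds x0. (d has_real_derivative d' x) (at x)"
    and d2: "(d' has_real_derivative D) (at x0)" and "D > 0" and "d' x0 = 0"
  shows "\<forall>\<^sub>F x in nhds x0. d x0 \<le> d x"
proof -
  obtain e1 where e1: "e1 > 0" "\<And>x. dist x x0 < e1 \<Longrightarrow> (d has_real_derivative d' x) (at x)"
    using d unfolding eventually_nhds_metric by blast
  obtain e2 where e2: "e2 > 0" "\<And>h. 0 < h \<Longrightarrow> h < e2 \<Longrightarrow> d' x0 < d' (x0 + h)"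
    using DERIV_pos_inc_right[OF d2 \<open>D > 0\<close>] by blast
  obtain e3 where e3: "e3 > 0" "\<And>h. 0 < h \<Longrightarrow> h < e3 \<Longrightarrow> d' (x0 - h) < d' x0"
    using DERIV_pos_inc_left[OF d2 \<open>D > 0\<close>] by blast
  define e where "e = min e1 (min e2 e3)"
  have "e > 0" using e1 e2 e3 by (simp add: e_def)
  moreover have "d x0 \<le> d x" if x: "dist x x0 < e" for x
  proof (cases x x0 rule: linorder_cases)
    case less
    have "\<exists>z. x < z \<and> z < x0 \<and> d x0 - d x = (x0 - x) * d' z"
      using less x by (intro MVT2 e1(2)) (auto simp: dist_real_def e_def)
    then obtain z where z: "x < z" "z < x0" "d x0 - d x = (x0 - x) * d' z" by blast
    have "d' z < 0" using e3(2)[of "x0 - z"] z x \<open>d' x0 = 0\<close> by (auto simp: dist_real_def e_def)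
    then have "(x0 - x) * d' z \<le> 0" using less by (simp add: mult_le_0_iff)
    with z show ?thesis by simp
  next
    case greater
    have "\<exists>z. x0 < z \<and> z < x \<and> d x - d x0 = (x - x0) * d' z"
      using greater x by (intro MVT2 e1(2)) (auto simp: dist_real_def e_def)
    then obtain z where z: "x0 < z" "z < x" "d x - d x0 = (x - x0) * d' z" by blast
    have "d' z > 0" using e2(2)[of "z - x0"] z x \<open>d' x0 = 0\<close> by (auto simp: dist_real_def e_def)
    then have "(x - x0) * d' z \<ge> 0" using greater by simp
    with z show ?thesis by simp
  qed simp
  ultimately show ?thesis unfolding eventually_nhds_metric by blast
qed

text \<open>With \<open>s\<close> the squared distance from \<open>z\<close> to a contact point,
  \<open>a\<close>, \<open>b\<close> and \<open>2 * e\<close> are the value and the first two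
  derivatives there in the variable |x - z|^2.\<close>

definition radial_quadratic :: "real \<Rightarrow> real \<Rightarrow> real \<Rightarrow> real \<Rightarrow> real ^ 'n \<Rightarrow> real ^ 'n::finite \<Rightarrow> real" where
  "radial_quadratic a b e s z x =
     a + b * ((x - z) \<bullet> (x - z) - s) + e * ((x - z) \<bullet> (x - z) - s)\<^sup>2"

lemma has_derivative_radial_quadratic:
  "(radial_quadratic a b e s z has_derivative
     (\<lambda>v. 2 * (v \<bullet> (x - z)) * (b + 2 * e * ((x - z) \<bullet> (x - z) - s)))) (at x)"
  unfolding radial_quadratic_def
  by (auto intro!: derivative_eq_intros simp: algebra_simps inner_commute)

lemma partial_deriv_radial_quadratic:
  "partial_deriv i (radial_quadratic a b e s z) =
     (\<lambda>x. 2 * (x - z) $ i * (b + 2 * e * ((x - z) \<bullet> (x - z) - s)))"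
  unfolding partial_deriv_def
  by (auto simp: fun_eq_iff frechet_derivative_at[OF has_derivative_radial_quadratic, symmetric]
      inner_axis')

lemma has_derivative_partial_deriv_radial_quadratic:
  "(partial_deriv i (radial_quadratic a b e s z) has_derivative
     (\<lambda>v. 2 * v $ i * (b + 2 * e * ((x - z) \<bullet> (x - z) - s)) +
          8 * e * (x - z) $ i * (v \<bullet> (x - z)))) (at x)"
  unfolding partial_deriv_radial_quadratic
  by (auto intro!: derivative_eq_intros bounded_linear.has_derivative[OF bounded_linear_vec_nth]
      simp: algebra_simps inner_commute)

lemma partial_deriv2_radial_quadratic:
  "partial_deriv j (partial_deriv i (radial_quadratic a b e s z)) =
     (\<lambda>x. 2 * axis j 1 $ i * (b + 2 * e * ((x - z) \<bullet> (x - z) - s)) +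
          8 * e * (x - z) $ i * (x - z) $ j)"
  unfolding partial_deriv_def[of j]
  by (auto simp: fun_eq_iff
      frechet_derivative_at[OF has_derivative_partial_deriv_radial_quadratic, symmetric]
      inner_axis')

lemma C2_on_radial_quadratic: "C2_on S (radial_quadratic a b e s z)"
  unfolding C2_on_def C1_on_def
proof (intro conjI allI ballI)
  show "radial_quadratic a b e s z differentiable at x" for x
    using has_derivative_radial_quadratic differentiableI by blast
  show "partial_deriv i (radial_quadratic a b e s z) differentiable at x" for i x
    using has_derivative_partial_deriv_radial_quadratic differentiableI by blast
  show "continuous_on S (partial_deriv i (radial_quadratic a b e s z))" for i
    unfolding partial_deriv_radial_quadratic by (intro continuous_intros)
  show "continuous_on S (partial_deriv j (partial_deriv i (radial_quadratic a b e s z)))" for i j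
    unfolding partial_deriv2_radial_quadratic by (intro continuous_intros)
qed

text \<open>With w = y - z, the gradient at \<open>y\<close> is 2b w and the Hessian is 2b I + 8e w
  w^T. The formula is the quadratic form of this Hessian at the gradient, with |w|^2 = s.\<close>

lemma infinity_Laplacian_radial_quadratic:
  assumes "(y - z) \<bullet> (y - z) = s"
  shows "infinity_Laplacian (radial_quadratic a b e s z) y = 8 * b ^ 3 * s + 32 * b\<^sup>2 * e * s\<^sup>2"
proof -
  define w where "w = y - z"
  have s: "s = (\<Sum>i\<in>UNIV. (w $ i)\<^sup>2)"
    using assms by (simp add: w_def inner_vec_def power2_eq_square)
  have "infinity_Laplacian (radial_quadratic a b e s z) y =
      (\<Sum>i\<in>UNIV. \<Sum>j\<in>UNIV. (2 * w $ i * b) * (2 * w $ j * b) *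
         (2 * axis j 1 $ i * b + 8 * e * w $ i * w $ j))"
    unfolding infinity_Laplacian_def partial_deriv2_radial_quadratic
    unfolding partial_deriv_radial_quadratic using assms by (simp add: w_def)
  also have "\<dots> = (\<Sum>i\<in>UNIV. (\<Sum>j\<in>UNIV. if i = j then 8 * b ^ 3 * (w $ i)\<^sup>2 else 0) +
         32 * b\<^sup>2 * e * (w $ i)\<^sup>2 * (\<Sum>j\<in>UNIV. (w $ j)\<^sup>2))"
    unfolding sum_distrib_left sum.distrib[symmetric]
    by (intro sum.cong refl) (auto simp: axis_def algebra_simps power2_eq_square power3_eq_cube)
  also have "\<dots> = (\<Sum>i\<in>UNIV. (8 * b ^ 3 + 32 * b\<^sup>2 * e * s) * (w $ i)\<^sup>2)"
    unfolding s[symmetric] by (simp add: algebra_simps)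
  also have "\<dots> = 8 * b ^ 3 * s + 32 * b\<^sup>2 * e * s\<^sup>2"
    unfolding sum_distrib_left[symmetric] s[symmetric]
    by (simp add: algebra_simps power2_eq_square)
  finally show ?thesis .
qed

text \<open>A radial function need only be twice differentiable near the contact point to serve as a
  test function: it is replaced there by a slightly flatter quadratic in \<open>|x - z|\<^sup>2\<close>, which is a
  polynomial and so of class \<open>C\<^sup>2\<close> everywhere.\<close>

lemma supersolution_radial_test:
  fixes u :: "real ^ 'n \<Rightarrow> real"
  assumes sup: "viscosity_supersolution f \<Omega> u" and y: "y \<in> \<Omega>" and "y \<noteq> z"
    and h: "\<forall>\<^sub>F r in nhds (norm (y - z)). (h has_real_derivative h' r) (at r)"
    and h2: "(h' has_real_derivative D) (at (norm (y - z)))"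
    and touch: "\<forall>\<^sub>F x in nhds y. u y - h (norm (y - z)) \<le> u x - h (norm (x - z))"
  shows "(h' (norm (y - z)))\<^sup>2 * D \<le> f (u y)"
proof -
  define \<rho> where "\<rho> = norm (y - z)"
  define p where "p = h' \<rho>"
  have "\<rho> > 0" using \<open>y \<noteq> z\<close> by (simp add: \<rho>_def)
  \<comment> \<open>Strictness leaves \<open>h\<close> minus the quadratic with the positive second
    derivative \<open>D - \<eta>\<close> at the contact radius. The value \<open>D\<close> itself is
    recovered at the end by letting \<eta> increase to it.\<close>
  have ineq: "p\<^sup>2 * \<eta> \<le> f (u y)" if "\<eta> < D" for \<eta>
  proof -
    \<comment> \<open>As a function of the radius, the quadratic then has first derivative
      \<open>p\<close> and second derivative \<open>2 * b + 8 * e * \<rho>\<^sup>2 = \<eta>\<close>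
      at \<rho>.\<close>
    define b where "b = p / (2 * \<rho>)"
    define e where "e = \<eta> / (8 * \<rho>\<^sup>2) - p / (8 * \<rho> ^ 3)"
    define d where "d r = h r - (b * (r\<^sup>2 - \<rho>\<^sup>2) + e * (r\<^sup>2 - \<rho>\<^sup>2)\<^sup>2)" for r
    define d' where "d' r = h' r - 2 * r * (b + 2 * e * (r\<^sup>2 - \<rho>\<^sup>2))" for r
    have "\<forall>\<^sub>F r in nhds \<rho>. (d has_real_derivative d' r) (at r)"
      using h unfolding \<rho>_def[symmetric]
      by eventually_elim
        (auto simp: d_def[abs_def] d'_def algebra_simps power2_eq_square
          intro!: derivative_eq_intros)
    moreover have "(d' has_real_derivative (D - \<eta>)) (at \<rho>)"
    proof -
      have "(d' has_real_derivative (D - (2 * b + 8 * e * \<rho>\<^sup>2))) (at \<rho>)"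
        using h2 unfolding \<rho>_def[symmetric] d'_def
        by (auto intro!: derivative_eq_intros simp: algebra_simps power2_eq_square)
      also have "2 * b + 8 * e * \<rho>\<^sup>2 = \<eta>"
        using \<open>\<rho> > 0\<close> by (simp add: b_def e_def field_simps power2_eq_square power3_eq_cube)
      finally show ?thesis .
    qed
    moreover have "d' \<rho> = 0"
      using \<open>\<rho> > 0\<close> by (simp add: d'_def b_def p_def)
    ultimately have "\<forall>\<^sub>F r in nhds \<rho>. d \<rho> \<le> d r"
      using \<open>\<eta> < D\<close> by (intro second_derivative_local_min[where d' = d' and D = "D - \<eta>"]) auto
    moreover have "((\<lambda>x. norm (x - z)) \<longlongrightarrow> \<rho>) (nhds y)"
      unfolding \<rho>_def by (intro tendsto_norm tendsto_diff tendsto_const filterlim_ident)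
    ultimately have dmin: "\<forall>\<^sub>F x in nhds y. d \<rho> \<le> d (norm (x - z))"
      by (rule eventually_compose_filterlim)
    let ?\<phi> = "radial_quadratic (u y) b e (\<rho>\<^sup>2) z"
    have sq: "(y - z) \<bullet> (y - z) = \<rho>\<^sup>2" by (simp add: \<rho>_def dot_square_norm)
    have \<phi>y: "?\<phi> y = u y" using sq by (simp add: radial_quadratic_def)
    \<comment> \<open>Up to a constant, u minus the test function is the sum of u - h(|x - z|) and
      d(|x - z|), both with a local minimum at \<open>y\<close>.\<close>
    have "\<forall>\<^sub>F x in nhds y. u y - ?\<phi> y \<le> u x - ?\<phi> x"
      using dmin touch unfolding \<rho>_def[symmetric]
      by eventually_elim (simp add: \<phi>y, simp add: d_def radial_quadratic_def dot_square_norm)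
    then have "\<forall>\<^sub>F x in at y within \<Omega>. u y - ?\<phi> y \<le> u x - ?\<phi> x"
      by (auto simp: eventually_at_filter elim: eventually_mono)
    then have "infinity_Laplacian ?\<phi> y \<le> f (?\<phi> y)"
      using sup y \<phi>y C2_on_radial_quadratic unfolding viscosity_supersolution_def by blast
    moreover have "infinity_Laplacian ?\<phi> y = p\<^sup>2 * \<eta>"
      unfolding infinity_Laplacian_radial_quadratic[OF sq] using \<open>\<rho> > 0\<close>
      by (simp add: b_def e_def field_simps power2_eq_square power3_eq_cube)
    ultimately show ?thesis using \<phi>y by simp
  qed
  have "((\<lambda>\<eta>. p\<^sup>2 * \<eta>) \<longlongrightarrow> p\<^sup>2 * D) (at_left D)"
    by (intro tendsto_intros)
  then have "p\<^sup>2 * D \<le> f (u y)"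
    by (rule tendsto_upperbound)
      (auto simp: eventually_at_filter ineq)
  then show ?thesis by (simp add: p_def \<rho>_def)
qed

section \<open>Power bound for the nonlinearity and comparison with the barrier\<close>

text \<open>The growth condition is read at t = 1. Since \<open>f\<close> need not be monotone, the
  bound is stated with a separate \<open>w\<close>, later the barrier value above \<open>s\<close>.
  Requiring \<open>w > 0\<close> also matters for \<gamma> = 0 and \<open>s = 0\<close>, because
  \<open>0 powr 0 = 0\<close>.\<close>

lemma growth_condition_power_bound:
  assumes f: "continuous_on {0..} f" and g: "growth_condition f M \<gamma>" and "M > 0" "\<gamma> \<ge> 0"
  obtains \<delta> where "\<delta> > 0" "f 1 \<ge> 0"
    "\<And>s w. 0 \<le> s \<Longrightarrow> s \<le> w \<Longrightarrow> 0 < w \<Longrightarrow> w < \<delta> \<Longrightarrow> f s \<le> M * f 1 * w powr \<gamma>"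
proof -
  obtain \<delta> where \<delta>: "\<delta> > 0" and
    b: "\<And>s. 0 < s \<Longrightarrow> s < \<delta> \<Longrightarrow> 0 \<le> f s \<and> f s \<le> M * s powr \<gamma> * f 1"
    using g unfolding growth_condition_def
    by (metis less_numeral_extra(1) mult.right_neutral order_refl)
  have "0 \<le> M * (\<delta>/2) powr \<gamma> * f 1" using b[of "\<delta>/2"] \<delta> by auto
  moreover have "0 < M * (\<delta>/2) powr \<gamma>" using \<open>M > 0\<close> \<delta> by simp
  ultimately have f1: "f 1 \<ge> 0" by (simp add: zero_le_mult_iff)
  have pos: "f s \<le> M * f 1 * w powr \<gamma>" if "0 < s" "s \<le> w" "w < \<delta>" for s w
  proof -
    have "f s \<le> M * f 1 * s powr \<gamma>" using b[of s] that by (simp add: mult_ac)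
    also have "\<dots> \<le> M * f 1 * w powr \<gamma>"
      using that f1 \<open>M > 0\<close> \<open>\<gamma> \<ge> 0\<close> by (intro mult_left_mono powr_mono2) auto
    finally show ?thesis .
  qed
  \<comment> \<open>The growth condition speaks only of positive arguments; the value at 0 is
    reached by continuity from the right.\<close>
  have zero: "f 0 \<le> M * f 1 * w powr \<gamma>" if "0 < w" "w < \<delta>" for w
  proof -
    have "(f \<longlongrightarrow> f 0) (at 0 within {0..})" using f by (auto simp: continuous_on_def)
    then have lim: "(f \<longlongrightarrow> f 0) (at_right 0)" by (rule tendsto_within_subset) auto
    have "\<forall>\<^sub>F s in at_right 0. f s \<le> M * f 1 * w powr \<gamma>"
      unfolding eventually_at_right_field using that pos by (intro exI[of _ w]) auto
    with lim show ?thesis by (rule tendsto_upperbound) auto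
  qed
  show ?thesis
  proof (rule that[OF \<delta> f1])
    fix s w assume "0 \<le> s" "s \<le> w" "0 < w" "w < \<delta>"
    then show "f s \<le> M * f 1 * w powr \<gamma>" using pos zero by (cases "s = 0") auto
  qed
qed

text \<open>If \<open>u x\<close> were not positive, \<open>u\<close> minus the barrier would have a
  negative minimum over the closed ball. The minimum point is neither on the sphere nor at the
  centre, so the barrier can be tested there, against its strictness.\<close>

lemma barrier_bound:
  fixes u :: "real ^ 'n \<Rightarrow> real"
  assumes sup: "viscosity_supersolution f \<Omega> u" and \<gamma>: "0 \<le> \<gamma>" "\<gamma> < 3"
    and \<alpha>: "\<alpha> = 4 / (3 - \<gamma>)" and "c > 0"
    and c: "K < c powr (3 - \<gamma>) * \<alpha> ^ 3 * (\<alpha> - 1)"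
    and f: "\<And>s w. 0 \<le> s \<Longrightarrow> s \<le> w \<Longrightarrow> 0 < w \<Longrightarrow> w \<le> c * R powr \<alpha> \<Longrightarrow> f s \<le> K * w powr \<gamma>"
    and R: "cball z R \<subseteq> \<Omega>" "c * R powr \<alpha> < u z"
    and x: "dist z x < R"
  shows "u x > 0"
proof (rule ccontr)
  assume "\<not> u x > 0"
  have "R > 0" using x zero_le_dist[of z x] by linarith
  have "\<alpha> > 1" using \<gamma> by (simp add: \<alpha> field_simps)
  define h where "h r = c * (R - r) powr \<alpha>" for r
  have u0: "u v \<ge> 0" if "v \<in> cball z R" for v
    using sup R that unfolding viscosity_supersolution_def by auto
  have cu: "continuous_on (cball z R) u"
    using sup R unfolding viscosity_supersolution_def by (auto intro: continuous_on_subset)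
  have "continuous_on (cball z R) (\<lambda>v. u v - h (dist z v))"
    unfolding h_def using \<open>\<alpha> > 1\<close>
    by (intro continuous_intros cu continuous_on_powr') auto
  moreover have "cball z R \<noteq> {}" using \<open>R > 0\<close> by simp
  ultimately obtain y where y: "y \<in> cball z R"
    and ymin: "\<And>v. v \<in> cball z R \<Longrightarrow> u y - h (dist z y) \<le> u v - h (dist z v)"
    using continuous_attains_inf[OF compact_cball, of z R "\<lambda>v. u v - h (dist z v)"] by blast
  have "u x - h (dist z x) < 0"
    using \<open>\<not> u x > 0\<close> x \<open>c > 0\<close> by (smt (verit) h_def mult_pos_pos powr_gt_zero)
  with ymin[of x] x have neg: "u y < h (dist z y)" by auto
  with u0[OF y] have hpos: "h (dist z y) > 0" by linarith
  \<comment> \<open>The barrier vanishes on the sphere, as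
    \<open>0 powr \<alpha> = 0\<close>.\<close>
  then have "dist z y \<noteq> R" by (auto simp: h_def)
  with y have yR: "dist z y < R" by auto
  \<comment> \<open>At the centre the barrier is \<open>c * R powr \<alpha>\<close>, below
    \<open>u z\<close>. This point must be excluded because |x - z| is not differentiable
    there.\<close>
  have "y \<noteq> z" using neg R by (auto simp: h_def)
  define m where "m = R - dist z y"
  have "m > 0" using yR by (simp add: m_def)
  define D where "D = c * \<alpha> * (\<alpha> - 1) * m powr (\<alpha> - 2)"
  let ?h' = "\<lambda>r. - (c * \<alpha> * (R - r) powr (\<alpha> - 1))"
  have nyz: "norm (y - z) = dist z y" by (simp add: dist_norm norm_minus_commute)
  have "(?h' (norm (y - z)))\<^sup>2 * D \<le> f (u y)"
  proof (rule supersolution_radial_test[OF sup _ \<open>y \<noteq> z\<close>])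
    show "y \<in> \<Omega>" using y R by auto
    have "\<forall>\<^sub>F r in nhds (norm (y - z)). r < R"
      by (rule eventually_nhds_in_open[of "{..<R}", simplified]) (use yR nyz in auto)
    then show "\<forall>\<^sub>F r in nhds (norm (y - z)). (h has_real_derivative ?h' r) (at r)"
      unfolding h_def[abs_def]
      by eventually_elim (auto intro!: derivative_eq_intros)
    show "(?h' has_real_derivative D) (at (norm (y - z)))"
      unfolding D_def m_def nyz
      by (rule derivative_eq_intros refl | use yR in simp)+
    have "\<forall>\<^sub>F v in nhds y. v \<in> ball z R"
      using yR by (intro eventually_nhds_in_open) auto
    then show "\<forall>\<^sub>F v in nhds y. u y - h (norm (y - z)) \<le> u v - h (norm (v - z))"
      by eventually_elim (use ymin in \<open>auto simp: dist_norm norm_minus_commute\<close>)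
  qed
  moreover have "(?h' (norm (y - z)))\<^sup>2 * D = c ^ 3 * \<alpha> ^ 3 * (\<alpha> - 1) * m powr (\<alpha> * \<gamma>)"
  proof -
    \<comment> \<open>This identity dictates the exponent: it makes h'^2 h'' scale in
      \<open>m\<close> exactly like the power \<gamma> of \<open>h\<close>.\<close>
    have "\<alpha> * (3 - \<gamma>) = 4" using \<gamma> by (simp add: \<alpha> field_simps)
    then have e: "(\<alpha> - 1) + (\<alpha> - 1) + (\<alpha> - 2) = \<alpha> * \<gamma>"
      by (simp add: algebra_simps)
    have "m powr (\<alpha> - 1) * m powr (\<alpha> - 1) * m powr (\<alpha> - 2) = m powr (\<alpha> * \<gamma>)"
      unfolding powr_add[symmetric] e ..
    moreover have "(?h' (norm (y - z)))\<^sup>2 * D = c ^ 3 * \<alpha> ^ 3 * (\<alpha> - 1) *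
        (m powr (\<alpha> - 1) * m powr (\<alpha> - 1) * m powr (\<alpha> - 2))"
      unfolding nyz D_def m_def[symmetric] power2_eq_square power3_eq_cube by (simp only: mult_ac minus_mult_minus)
    ultimately show ?thesis by simp
  qed
  moreover have "f (u y) \<le> K * h (dist z y) powr \<gamma>"
  proof (rule f)
    show "h (dist z y) \<le> c * R powr \<alpha>"
      unfolding h_def using yR \<open>c > 0\<close> \<open>\<alpha> > 1\<close> by (intro mult_left_mono powr_mono2) auto
  qed (use u0[OF y] neg hpos in auto)
  moreover have "h (dist z y) powr \<gamma> = c powr \<gamma> * m powr (\<alpha> * \<gamma>)"
    using \<open>c > 0\<close> by (simp add: h_def m_def[symmetric] powr_mult powr_powr)
  moreover have "c ^ 3 = c powr \<gamma> * c powr (3 - \<gamma>)"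
    using \<open>c > 0\<close> by (simp add: powr_add[symmetric])
  \<comment> \<open>Splitting c^3 isolates a common positive factor; cancelling it contradicts the
    choice of \<open>c\<close>.\<close>
  ultimately have "(c powr \<gamma> * m powr (\<alpha> * \<gamma>)) * (c powr (3 - \<gamma>) * \<alpha> ^ 3 * (\<alpha> - 1))
      \<le> (c powr \<gamma> * m powr (\<alpha> * \<gamma>)) * K"
    by (simp add: mult_ac)
  then show False using c \<open>c > 0\<close> \<open>m > 0\<close> by simp
qed

section \<open>Choice of constants and growth at the free boundary\<close>

lemma exists_barrier_constant:
  fixes \<gamma> K :: real
  assumes "0 \<le> \<gamma>" "\<gamma> < 3"
  shows "\<exists>c>0. K < c powr (3 - \<gamma>) * (4 / (3 - \<gamma>)) ^ 3 * (4 / (3 - \<gamma>) - 1)"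
proof -
  define B where "B = (4 / (3 - \<gamma>)) ^ 3 * (4 / (3 - \<gamma>) - 1)"
  have "B > 0" using assms by (auto simp: B_def field_simps intro!: mult_pos_pos)
  \<comment> \<open>Solves \<open>c powr (3 - \<gamma>) * B = \<bar>K\<bar> + 1\<close>; the right
    side is positive and exceeds \<open>K\<close> whatever the sign of \<open>K\<close>.\<close>
  define c where "c = ((\<bar>K\<bar> + 1) / B) powr (1 / (3 - \<gamma>))"
  have "c > 0" using \<open>B > 0\<close> by (simp add: c_def)
  have "c powr (3 - \<gamma>) = (\<bar>K\<bar> + 1) / B"
    using assms \<open>B > 0\<close> by (simp add: c_def powr_powr)
  then have "c powr (3 - \<gamma>) * B = \<bar>K\<bar> + 1" using \<open>B > 0\<close> by simp
  then have "K < c powr (3 - \<gamma>) * B" by simp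
  with \<open>c > 0\<close> show ?thesis by (auto simp: B_def mult.assoc)
qed

lemma frontier_positivity_set_zero:
  assumes "open \<Omega>" "viscosity_supersolution f \<Omega> u" "x0 \<in> frontier (positivity_set \<Omega> u) \<inter> \<Omega>"
  shows "u x0 = 0"
proof -
  have "continuous_on \<Omega> u" "0 \<le> u x0"
    using assms by (auto simp: viscosity_supersolution_def)
  have "positivity_set \<Omega> u = \<Omega> \<inter> u -` {0<..}" by (auto simp: positivity_set_def)
  \<comment> \<open>An open set is disjoint from its frontier.\<close>
  then have "open (positivity_set \<Omega> u)"
    using continuous_on_open_vimage[OF \<open>open \<Omega>\<close>] \<open>continuous_on \<Omega> u\<close>
    by (metis Int_commute open_greaterThan)
  then have "x0 \<notin> positivity_set \<Omega> u"
    using assms(3) by (auto simp: frontier_def interior_open)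
  with \<open>0 \<le> u x0\<close> assms(3) show ?thesis by (auto simp: positivity_set_def)
qed

lemma growth_near_free_boundary:
  fixes u :: "real ^ 'n \<Rightarrow> real"
  assumes f: "continuous_on {0..} f" "growth_condition f M \<gamma>" and "M > 0"
    and \<gamma>: "0 \<le> \<gamma>" "\<gamma> < 3" and "c > 0"
    and c: "M * f 1 < c powr (3 - \<gamma>) * (4 / (3 - \<gamma>)) ^ 3 * (4 / (3 - \<gamma>) - 1)"
    and \<Omega>: "open \<Omega>" "x0 \<in> \<Omega>" and sup: "viscosity_supersolution f \<Omega> u" and "u x0 = 0"
  shows "\<forall>\<^sub>F x in nhds x0. u x \<le> c * norm (x - x0) powr (4 / (3 - \<gamma>))"
proof -
  define \<alpha> where "\<alpha> = 4 / (3 - \<gamma>)"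
  have "\<alpha> > 0" using \<gamma> by (simp add: \<alpha>_def)
  obtain \<delta> where \<delta>: "\<delta> > 0"
    and fb: "\<And>s w. 0 \<le> s \<Longrightarrow> s \<le> w \<Longrightarrow> 0 < w \<Longrightarrow> w < \<delta> \<Longrightarrow> f s \<le> M * f 1 * w powr \<gamma>"
    using growth_condition_power_bound[OF f \<open>M > 0\<close> \<gamma>(1)] by metis
  obtain r where r: "r > 0" "ball x0 r \<subseteq> \<Omega>" using \<Omega> open_contains_ball by blast
  \<comment> \<open>The first bound keeps balls of radius below \<open>q\<close> centred within
    \<open>q\<close> of \<open>x0\<close> inside \<Omega>; the second keeps all barrier values below
    \<delta>, where the power bound on \<open>f\<close> holds.\<close>
  define q where "q = min (r / 2) ((\<delta> / c) powr (1 / \<alpha>))"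
  have "q > 0" using r \<delta> \<open>c > 0\<close> by (simp add: q_def)
  have "u x \<le> c * dist x x0 powr \<alpha>" if x: "dist x x0 < q" for x
  proof (rule ccontr)
    assume "\<not> ?thesis"
    then have "c * dist x x0 powr \<alpha> < u x" by simp
    \<comment> \<open>By continuity the strict inequality survives for some R > |x - x0|, which puts
      \<open>x0\<close> in the open ball about \<open>x\<close>.\<close>
    moreover have "((\<lambda>R. c * R powr \<alpha>) \<longlongrightarrow> c * dist x x0 powr \<alpha>) (at_right (dist x x0))"
      using \<open>\<alpha> > 0\<close>
      by (intro tendsto_intros tendsto_powr2)
        (auto simp: eventually_at_filter intro!: always_eventually order.trans[OF zero_le_dist less_imp_le])
    ultimately have "\<forall>\<^sub>F R in at_right (dist x x0). c * R powr \<alpha> < u x"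
      by (simp add: order_tendstoD(2))
    moreover have "\<forall>\<^sub>F R in at_right (dist x x0). R < q \<and> dist x x0 < R"
      using x by (auto simp: eventually_at_right_field)
    ultimately obtain R where R: "c * R powr \<alpha> < u x" "R < q" "dist x x0 < R"
      using eventually_happens[OF eventually_conj] by fastforce
    have "0 \<le> R" using R(3) zero_le_dist[of x x0] by linarith
    have small: "c * R powr \<alpha> < \<delta>"
    proof -
      have "R powr \<alpha> < ((\<delta> / c) powr (1 / \<alpha>)) powr \<alpha>"
        using R \<open>0 \<le> R\<close> \<open>\<alpha> > 0\<close> by (intro powr_less_mono2) (auto simp: q_def)
      also have "\<dots> = \<delta> / c" using \<open>\<alpha> > 0\<close> \<delta> \<open>c > 0\<close> by (simp add: powr_powr)
      finally show ?thesis using \<open>c > 0\<close> by (simp add: field_simps)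
    qed
    have "cball x R \<subseteq> \<Omega>"
    proof
      fix v assume "v \<in> cball x R"
      then have "dist x0 v \<le> dist x x0 + R"
        using dist_triangle[of x0 v x] by (simp add: dist_commute)
      then have "v \<in> ball x0 r" using R(2) x by (simp add: q_def)
      then show "v \<in> \<Omega>" using r by blast
    qed
    \<comment> \<open>The barrier is centred at \<open>x\<close> and evaluated at
      \<open>x0\<close>.\<close>
    then have "u x0 > 0"
      using small R c
      by (intro barrier_bound[OF sup \<gamma> \<alpha>_def \<open>c > 0\<close>, of "M * f 1" R x])
        (auto simp: \<alpha>_def intro!: fb)
    with \<open>u x0 = 0\<close> show False by simp
  qed
  then show ?thesis
    unfolding eventually_nhds_metric \<alpha>_def[symmetric] using \<open>q > 0\<close> by (auto simp: dist_norm)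
qed

theorem theorem3p1:
  fixes f :: "real \<Rightarrow> real" and M :: real
  assumes "continuous_on {0..} f" and "M > 0"
  shows "\<exists>C :: real \<Rightarrow> real \<Rightarrow> ereal \<Rightarrow> real. (\<forall>\<gamma> s d. C \<gamma> s d > 0) \<and>
    (\<forall>\<gamma> \<Omega> (u :: real ^ 'n \<Rightarrow> real) x0.
       0 \<le> \<gamma> \<and> \<gamma> < 3 \<and> growth_condition f M \<gamma> \<and>
       open \<Omega> \<and> viscosity_solution f \<Omega> u \<and> bounded (u ` \<Omega>) \<and>
       x0 \<in> frontier (positivity_set \<Omega> u) \<inter> \<Omega> \<longrightarrow>
       (\<forall>\<^sub>F x in nhds x0. x \<in> positivity_set \<Omega> u \<longrightarrow>
          u x \<le> C \<gamma> (sup_norm_on \<Omega> u) (boundary_dist \<Omega> x0) * norm (x - x0) powr (4 / (3 - \<gamma>))))"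
proof -
  \<comment> \<open>The range of \<gamma> is a premise inside the existential, so that the chosen
    function is positive for every real \<gamma>.\<close>
  have "\<exists>c>0. 0 \<le> \<gamma> \<and> \<gamma> < 3 \<longrightarrow>
      M * f 1 < c powr (3 - \<gamma>) * (4 / (3 - \<gamma>)) ^ 3 * (4 / (3 - \<gamma>) - 1)" for \<gamma>
    using exists_barrier_constant[of \<gamma> "M * f 1"] zero_less_one by blast
  then obtain c where c: "\<And>\<gamma>. c \<gamma> > 0"
    "\<And>\<gamma>. 0 \<le> \<gamma> \<Longrightarrow> \<gamma> < 3 \<Longrightarrow>
      M * f 1 < c \<gamma> powr (3 - \<gamma>) * (4 / (3 - \<gamma>)) ^ 3 * (4 / (3 - \<gamma>) - 1)"
    by metis
  show ?thesis
  proof (intro exI[of _ "\<lambda>\<gamma> s d. c \<gamma>"] conjI allI impI)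
    fix \<gamma> \<Omega> and u :: "real ^ 'n \<Rightarrow> real" and x0
    assume H: "0 \<le> \<gamma> \<and> \<gamma> < 3 \<and> growth_condition f M \<gamma> \<and>
       open \<Omega> \<and> viscosity_solution f \<Omega> u \<and> bounded (u ` \<Omega>) \<and>
       x0 \<in> frontier (positivity_set \<Omega> u) \<inter> \<Omega>"
    then have sup: "viscosity_supersolution f \<Omega> u" by (simp add: viscosity_solution_def)
    then have "u x0 = 0" using H frontier_positivity_set_zero by blast
    then have "\<forall>\<^sub>F x in nhds x0. u x \<le> c \<gamma> * norm (x - x0) powr (4 / (3 - \<gamma>))"
      using H by (intro growth_near_free_boundary[OF assms(1) _ assms(2) _ _ c(1) c(2) _ _ sup]) auto
    then show "\<forall>\<^sub>F x in nhds x0. x \<in> positivity_set \<Omega> u \<longrightarrow>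
        u x \<le> c \<gamma> * norm (x - x0) powr (4 / (3 - \<gamma>))"
      by (auto elim: eventually_mono)
  qed (use c in auto)
qed

end
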